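(* If $n$ is a positive integer, then $$\zeta_q(1-n,w\mid w_1)=-\frac{\beta_n(w:q\mid w_1)}{n}.$$
   Context: Let $q\in\mathbb{C}$ with $0<|q|<1$, fix a value of $\log q$, and put $q^x=\exp(x\log q)$, $[x]=\frac{1-q^x}{1-q}$. Let $w,w_1\in\mathbb{C}$ with $w_1\ne0$ and $|q^{w_1}|<1$. The Barnes' type Changhee $q$-Bernoulli polynomials $\beta_n(w:q\mid w_1)$ ($n\ge0$) are defined by $$\frac{q-1}{\log q}e^{\frac{t}{1-q}}-w_1t\sum_{m=0}^{\infty}q^{w_1m+w}e^{[w_1m+w]t}=\sum_{n=0}^{\infty}\beta_n(w:q\mid w_1)\frac{t^n}{n!}.$$ The Barnes' type Changhee $q$-zeta function is $$\zeta_q(s,w\mid w_1)=-\frac{(1-q)^s}{s-1}\frac{1}{\log q}+w_1\sum_{m=0}^{\infty}\frac{q^{w_1m+w}}{[w_1m+w]^s},\qquad s\in\mathbb{C},\ s\neq1.$$ At $s=1-n$ with $n\ge1$ an integer, the powers are ordinary integer powers (with $0^0=1$), so $[w_1m+w]^{-s}=[w_1m+w]^{n-1}$. *)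

theory Defs
  imports "HOL-Analysis.Analysis"
begin

text \<open>
  A branch of \<open>log q\<close> is passed explicitly as \<open>L\<close>; it is meant to satisfy \<open>exp L = q\<close>.
\<close>

definition q_pow :: "complex \<Rightarrow> complex \<Rightarrow> complex" where
  "q_pow L x = exp (x * L)"

definition q_bracket :: "complex \<Rightarrow> complex \<Rightarrow> complex \<Rightarrow> complex" where
  "q_bracket q L x = (1 - q_pow L x) / (1 - q)"

definition changhee_gen :: "complex \<Rightarrow> complex \<Rightarrow> complex \<Rightarrow> complex \<Rightarrow> complex \<Rightarrow> complex" where
  "changhee_gen q L w w1 t =
     (q - 1) / L * exp (t / (1 - q))
     - w1 * t * (\<Sum>m. q_pow L (w1 * of_nat m + w) * exp (q_bracket q L (w1 * of_nat m + w) * t))"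

definition changhee_bernoulli :: "complex \<Rightarrow> complex \<Rightarrow> complex \<Rightarrow> complex \<Rightarrow> nat \<Rightarrow> complex" where
  "changhee_bernoulli q L w w1 =
     (THE b. \<forall>t. (\<lambda>n. b n * t ^ n / fact n) sums changhee_gen q L w w1 t)"

text \<open>
  Integer exponents give ordinary integer powers, for every base; in particular \<open>0\<close> to the power
  \<open>0\<close> is \<open>1\<close>, whereas \<open>0 powr 0 = 0\<close>. Other exponents use the principal branch.
\<close>

definition cpower :: "complex \<Rightarrow> complex \<Rightarrow> complex" where
  "cpower z s = (if s \<in> \<int> then z powi \<lfloor>Re s\<rfloor> else z powr s)"

text \<open>
  The summand is written with exponent \<open>- s\<close> rather than as a quotient by the power with
  exponent \<open>s\<close>, so that no division by zero occurs at \<open>s = 1 - n\<close> when a bracket vanishes.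
\<close>

definition changhee_zeta :: "complex \<Rightarrow> complex \<Rightarrow> complex \<Rightarrow> complex \<Rightarrow> complex \<Rightarrow> complex" where
  "changhee_zeta q L s w w1 =
     - (cpower (1 - q) s / (s - 1)) * (1 / L)
     + w1 * (\<Sum>m. q_pow L (w1 * of_nat m + w) * cpower (q_bracket q L (w1 * of_nat m + w)) (- s))"

end

theory Submission
  imports Defs
begin

text \<open>
  Both sides are governed by the same numbers. With weights
  \<open>a\<^sub>m = q\<^bsup>w\<^sub>1m+w\<^esup>\<close>, nodes \<open>x\<^sub>m = [w\<^sub>1m+w]\<close>
  and moments \<open>M\<^sub>k = \<Sum>\<^sub>m a\<^sub>m x\<^sub>m\<^bsup>k\<^esup>\<close>, the series in the zeta function at
  \<open>s = 1 - n\<close> is \<open>M\<^bsub>n-1\<^esub>\<close>. The generating function of the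
  \<open>\<beta>\<^sub>n\<close> contains the exponential sum
  \<open>\<Sum>\<^sub>m a\<^sub>m exp (x\<^sub>m t)\<close>, which is the exponential generating function of the moments
  (\<open>moments_exp_generating_function\<close>). The factor \<open>t\<close> in front shifts the index, so that
  \<open>\<beta>\<^sub>n = (q - 1) / (L (1 - q)\<^bsup>n\<^esup>) - n w\<^sub>1 M\<^bsub>n-1\<^esub>\<close> (\<open>changhee_bernoulli_eq\<close>); dividing by
  \<open>-n\<close> turns the two terms into the two terms of the zeta function.

  The interchange of summations behind the moment expansion works because the weights
  form a geometric progression of ratio \<open>q\<^bsup>w\<^sub>1\<^esup>\<close>, hence are absolutely summable, while the
  nodes are affine in the weights, hence bounded.
\<close>

section \<open>Exponential generating functions\<close>

lemma norm_exp_partial_sum_le: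
  fixes z :: complex
  shows "norm (\<Sum>k<K. z ^ k / fact k) \<le> exp (norm z)"
proof -
  have sums: "(\<lambda>k. norm z ^ k / fact k) sums exp (norm z)"
    using exp_converges[of "norm z"] by (simp add: divide_inverse mult.commute)
  have "norm (\<Sum>k<K. z ^ k / fact k) \<le> (\<Sum>k<K. norm z ^ k / fact k)"
    by (rule sum_norm_le) (simp add: norm_divide norm_power)
  also have "\<dots> \<le> exp (norm z)"
    using sum_le_suminf[OF sums_summable[OF sums], of "{..<K}"] sums_unique[OF sums] by simp
  finally show ?thesis .
qed

lemma summable_moment:
  fixes a x :: "nat \<Rightarrow> complex"
  assumes a: "summable (\<lambda>m. norm (a m))" and x: "\<And>m. norm (x m) \<le> C"
  shows "summable (\<lambda>m. a m * x m ^ k)"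
proof (rule summable_comparison_test')
  show "summable (\<lambda>m. norm (a m) * C ^ k)"
    using a by (rule summable_mult2)
  show "norm (a m * x m ^ k) \<le> norm (a m) * C ^ k" for m
    using x[of m] by (auto simp: norm_mult norm_power intro!: mult_left_mono power_mono)
qed

text \<open>
  The claim is that a double series may be summed in either order. Truncating the exponential
  after \<open>K\<close> terms leaves only finite sums of moments, and letting \<open>K\<close> grow is a limit under the
  sum over \<open>m\<close>, which the majorant \<open>norm (a m) * exp (C * norm t)\<close>, uniform in \<open>K\<close>, justifies by
  Tannery's theorem.
\<close>

lemma moments_exp_generating_function:
  fixes a x :: "nat \<Rightarrow> complex"
  assumes a: "summable (\<lambda>m. norm (a m))" and x: "\<And>m. norm (x m) \<le> C"
  shows "(\<lambda>k. (\<Sum>m. a m * x m ^ k) * t ^ k / fact k) sums (\<Sum>m. a m * exp (x m * t))"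
proof -
  let ?T = "\<lambda>m K. a m * (\<Sum>k<K. (x m * t) ^ k / fact k)"
  have lim: "(\<lambda>K. ?T m K) \<longlonglongrightarrow> a m * exp (x m * t)" for m
  proof (intro tendsto_intros)
    show "(\<lambda>K. \<Sum>k<K. (x m * t) ^ k / fact k) \<longlonglongrightarrow> exp (x m * t)"
      using exp_converges[of "x m * t"]
      by (simp add: sums_def scaleR_conv_of_real field_simps)
  qed
  have bound: "norm (?T m K) \<le> norm (a m) * exp (C * norm t)" for m K
  proof -
    have "exp (norm (x m * t)) \<le> exp (C * norm t)"
      using x[of m] by (simp add: norm_mult mult_right_mono)
    then have "norm (\<Sum>k<K. (x m * t) ^ k / fact k) \<le> exp (C * norm t)"
      using norm_exp_partial_sum_le[where z = "x m * t" and K = K] by linarith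
    then show ?thesis
      by (simp add: norm_mult mult_left_mono)
  qed
  have "(\<lambda>K. \<Sum>m. ?T m K) \<longlonglongrightarrow> (\<Sum>m. a m * exp (x m * t))"
    using tannerys_theorem[of ?T "\<lambda>m. a m * exp (x m * t)" sequentially
        "\<lambda>m. norm (a m) * exp (C * norm t)"] lim bound summable_mult2[OF a]
    by (simp add: always_eventually case_prod_beta)
  moreover have "(\<Sum>m. ?T m K) = (\<Sum>k<K. (\<Sum>m. a m * x m ^ k) * t ^ k / fact k)" for K
  proof -
    have sm: "summable (\<lambda>m. a m * x m ^ k)" for k
      using summable_moment[OF a x] .
    have "(\<Sum>m. ?T m K) = (\<Sum>m. \<Sum>k<K. a m * x m ^ k * (t ^ k / fact k))"
      by (simp add: sum_distrib_left power_mult_distrib mult_ac)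
    also have "\<dots> = (\<Sum>k<K. \<Sum>m. a m * x m ^ k * (t ^ k / fact k))"
      by (rule suminf_sum) (rule summable_mult2[OF sm])
    also have "\<dots> = (\<Sum>k<K. (\<Sum>m. a m * x m ^ k) * t ^ k / fact k)"
      by (intro sum.cong refl) (subst suminf_mult2[OF sm, symmetric], simp)
    finally show ?thesis .
  qed
  ultimately show ?thesis
    by (simp add: sums_def)
qed

text \<open>
  This makes the definite description in \<open>changhee_bernoulli\<close> denote: once an explicit sequence is
  found to expand the generating function, it is the sequence of the \<open>\<beta>\<^sub>n\<close>. Convergence at a single
  \<open>t \<noteq> 0\<close> already gives a positive radius, so the identity theorem for power series applies.
\<close>

lemma exp_generating_function_unique:
  fixes b c :: "nat \<Rightarrow> complex"
  assumes b: "\<And>t. (\<lambda>n. b n * t ^ n / fact n) sums f t"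
    and c: "\<And>t. (\<lambda>n. c n * t ^ n / fact n) sums f t"
  shows "b = c"
proof -
  define B where "B = Abs_fps (\<lambda>n. b n / fact n)"
  define C where "C = Abs_fps (\<lambda>n. c n / fact n)"
  have B: "(\<lambda>n. fps_nth B n * t ^ n) sums f t" for t
    using b[of t] by (simp add: B_def)
  have C: "(\<lambda>n. fps_nth C n * t ^ n) sums f t" for t
    using c[of t] by (simp add: C_def)
  have pos: "fps_conv_radius F > 0"
    if "\<And>t. (\<lambda>n. fps_nth F n * t ^ n) sums f t" for F
  proof -
    have "fps_conv_radius F \<ge> norm (1::complex)"
      unfolding fps_conv_radius_def
      by (rule conv_radius_geI) (use that[of 1] in \<open>simp add: sums_iff\<close>)
    then show ?thesis
      by (rule less_le_trans[rotated]) simp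
  qed
  have "eval_fps B t = eval_fps C t" for t
    using B C by (simp add: eval_fps_def sums_iff)
  then have "B = C"
    by (intro eval_fps_eqD pos B C) simp
  then have "b n / fact n = c n / fact n" for n
    by (metis B_def C_def fps_nth_Abs_fps)
  then show ?thesis
    by (simp add: fun_eq_iff)
qed

section \<open>Weights and nodes of the q-series\<close>

lemma q_pow_progression: "q_pow L (w1 * of_nat m + w) = q_pow L w * q_pow L w1 ^ m"
  by (simp add: q_pow_def exp_add[symmetric] exp_of_nat_mult[symmetric] algebra_simps)

lemma summable_norm_q_pow:
  assumes "norm (q_pow L w1) < 1"
  shows "summable (\<lambda>m. norm (q_pow L (w1 * of_nat m + w)))"
  using assms by (simp add: q_pow_progression norm_mult norm_power summable_mult)

lemma norm_q_bracket_le: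
  assumes "norm (q_pow L w1) < 1"
  shows "norm (q_bracket q L (w1 * of_nat m + w)) \<le> (1 + norm (q_pow L w)) / norm (1 - q)"
proof -
  have "norm (q_pow L w * q_pow L w1 ^ m) \<le> norm (q_pow L w)"
    using assms by (simp add: norm_mult norm_power mult_left_le power_le_one)
  then have "norm (1 - q_pow L w * q_pow L w1 ^ m) \<le> 1 + norm (q_pow L w)"
    using norm_triangle_ineq4[of 1 "q_pow L w * q_pow L w1 ^ m"] by simp
  then show ?thesis
    by (simp add: q_bracket_def q_pow_progression norm_divide divide_right_mono)
qed

definition q_moment :: "complex \<Rightarrow> complex \<Rightarrow> complex \<Rightarrow> complex \<Rightarrow> nat \<Rightarrow> complex" where
  "q_moment q L w w1 k =
     (\<Sum>m. q_pow L (w1 * of_nat m + w) * q_bracket q L (w1 * of_nat m + w) ^ k)"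

section \<open>Bernoulli numbers and zeta values in terms of moments\<close>

lemma changhee_gen_sums:
  assumes "norm (q_pow L w1) < 1"
  shows "(\<lambda>n. ((q - 1) / L / (1 - q) ^ n - w1 * (of_nat n * q_moment q L w w1 (n - 1)))
            * t ^ n / fact n) sums changhee_gen q L w w1 t"
proof -
  let ?M = "q_moment q L w w1"
  let ?S = "\<Sum>m. q_pow L (w1 * of_nat m + w) * exp (q_bracket q L (w1 * of_nat m + w) * t)"
  have "(\<lambda>k. ?M k * t ^ k / fact k) sums ?S"
    using moments_exp_generating_function[OF summable_norm_q_pow norm_q_bracket_le] assms
    by (simp add: q_moment_def)
  from sums_mult[OF this, of t]
  have "(\<lambda>k. of_nat (Suc k) * ?M (Suc k - 1) * t ^ Suc k / fact (Suc k)) sums (t * ?S)"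
    by (simp add: mult_ac del: of_nat_Suc)
  \<comment> \<open>The term of index \<open>0\<close> vanishes because of the factor \<open>n\<close>, whatever the value of \<open>n - 1\<close>.\<close>
  then have shifted: "(\<lambda>n. of_nat n * ?M (n - 1) * t ^ n / fact n) sums (t * ?S)"
    by (rule sums_Suc_imp[rotated]) simp
  have "(\<lambda>n. (t / (1 - q)) ^ n / fact n) sums exp (t / (1 - q))"
    using exp_converges[of "t / (1 - q)"] by (simp add: scaleR_conv_of_real field_simps)
  from sums_diff[OF sums_mult[OF this, of "(q - 1) / L"] sums_mult[OF shifted, of w1]]
  have "(\<lambda>n. (q - 1) / L * ((t / (1 - q)) ^ n / fact n)
              - w1 * (of_nat n * ?M (n - 1) * t ^ n / fact n)) sums changhee_gen q L w w1 t"
    by (simp add: changhee_gen_def mult.assoc)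
  moreover have "c * ((t / (1 - q)) ^ n / fact n) - w1 * (of_nat n * ?M (n - 1) * t ^ n / fact n)
      = (c / (1 - q) ^ n - w1 * (of_nat n * ?M (n - 1))) * t ^ n / fact n" for c n
    by (simp add: power_divide diff_divide_distrib left_diff_distrib right_diff_distrib mult_ac)
  ultimately show ?thesis
    by (simp only:)
qed

lemma changhee_bernoulli_eq:
  assumes "norm (q_pow L w1) < 1"
  shows "changhee_bernoulli q L w w1 n =
           (q - 1) / L / (1 - q) ^ n - w1 * (of_nat n * q_moment q L w w1 (n - 1))"
proof -
  have "changhee_bernoulli q L w w1 =
          (\<lambda>n. (q - 1) / L / (1 - q) ^ n - w1 * (of_nat n * q_moment q L w w1 (n - 1)))"
    unfolding changhee_bernoulli_def
    using changhee_gen_sums[OF assms]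
    by (intro the_equality exp_generating_function_unique[where f = "changhee_gen q L w w1"]) auto
  then show ?thesis
    by simp
qed

lemma cpower_of_int: "cpower z (of_int k) = z powi k"
  by (simp add: cpower_def)

lemma changhee_zeta_eq:
  assumes "n \<ge> 1"
  shows "changhee_zeta q L (1 - of_nat n) w w1 =
           (1 - q) powi (1 - int n) / of_nat n / L + w1 * q_moment q L w w1 (n - 1)"
proof -
  have "cpower z (1 - of_nat n) = z powi (1 - int n)" for z
    using cpower_of_int[of z "1 - int n"] by simp
  moreover have "cpower z (- (1 - of_nat n)) = z ^ (n - 1)" for z
  proof -
    have "- (1 - of_nat n) = (of_int (int (n - 1)) :: complex)"
      using assms by (simp add: of_nat_diff)
    then show ?thesis
      by (simp only: cpower_of_int power_int_of_nat)
  qed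
  ultimately show ?thesis
    by (simp add: changhee_zeta_def q_moment_def)
qed

theorem theorem8:
  fixes q L w w1 :: complex and n :: nat
  assumes "0 < norm q" and "norm q < 1"
    and "exp L = q"
    and "w1 \<noteq> 0" and "norm (q_pow L w1) < 1"
    and "n \<ge> 1"
  shows "changhee_zeta q L (1 - of_nat n) w w1 = - (changhee_bernoulli q L w w1 n / of_nat n)"
proof -
  have q: "1 - q \<noteq> 0"
    using assms(2) by auto
  then have L: "L \<noteq> 0"
    using assms(3) by auto
  have "(1 - q) powi (1 - int n) = (1 - q) / (1 - q) ^ n"
    using q by (simp add: power_int_diff)
  moreover have "(1 - q) / P / of_nat n / L + w1 * M
      = - (((q - 1) / L / P - w1 * (of_nat n * M)) / of_nat n)" if "P \<noteq> 0" for P M :: complex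
    using that L assms(6) by (simp add: field_simps)
  ultimately show ?thesis
    unfolding changhee_zeta_eq[OF assms(6)] changhee_bernoulli_eq[OF assms(5)]
    using q by simp
qed

end
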